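(* Let $n>1$ be an integer, let $m=p^t$ be a prime power for some prime $p$ and integer $t\geq 0$, and suppose that every prime factor $q$ of $\binom{mn}{m}$ satisfies either $q=p$ or $q\equiv 1\pmod{m}$. Let $$T = \left\{q \text{ prime}: q\neq p,\ q \mid \tbinom{mn}{m},\ \alpha_q(mn)=m\right\}.$$ Then $$g(m,n) = \begin{cases} p\prod_{q\in T} q & \text{if } n \text{ is a power of } p,\\ \prod_{q\in T} q & \text{otherwise.}\end{cases}$$
   Context: For a positive integer $m$ and an integer $n>1$, $g(m,n)$ denotes the greatest common divisor of the set of binomial coefficients $\left\{\binom{mn}{mk}: 1\leq k<n\right\}$, $k$ ranging over integers. $\alpha_q(a)$ denotes the sum of the digits of $a$ written in base $q$. "$n$ is a power of $p$" means $n=p^i$ for some integer $i\geq 0$. An empty product equals $1$. *)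

theory Defs
  imports "HOL-Number_Theory.Number_Theory"
begin

definition binom_gcd :: "nat \<Rightarrow> nat \<Rightarrow> nat" where
  "binom_gcd m n = Gcd {(m * n) choose (m * k) | k. 1 \<le> k \<and> k < n}"

text \<open>
  Only meaningful for bases \<open>q \<ge> 2\<close>: the positions of the digits of \<open>a\<close> are then exactly
  the finitely many \<open>i\<close> with \<open>q ^ i \<le> a\<close>, and the digit at position \<open>i\<close>
  is \<open>a div q ^ i mod q\<close>.
\<close>
definition digit_sum :: "nat \<Rightarrow> nat \<Rightarrow> nat" where
  "digit_sum q a = (\<Sum>i | q ^ i \<le> a. a div q ^ i mod q)"

end

theory Submission
  imports Defs
begin

text \<open>
  By Kummer's theorem, for a prime \<open>q\<close> the number \<open>(q - 1) * v\<close>, where \<open>v\<close> is the exponent of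
  \<open>q\<close> in \<open>(a + b) choose a\<close>, equals the excess of the digit sums of \<open>a\<close> and \<open>b\<close> over that of
  \<open>a + b\<close>, in base \<open>q\<close>; it is \<open>q - 1\<close> for each carry in the addition.

  Suppose that \<open>q \<equiv> 1\<close> modulo \<open>m\<close>. Then a number is congruent to its digit sum modulo \<open>m\<close>, so the
  positive multiples of \<open>m\<close> have digit sum at least \<open>m\<close>. If \<open>m * n\<close> itself has digit sum exactly
  \<open>m\<close>, it cannot be a carry-free sum of two positive multiples of \<open>m\<close>, so \<open>q\<close> divides all the
  binomial coefficients; and splitting one leading unit \<open>q ^ Suc j\<close> of \<open>m * n\<close> as \<open>q\<close> copies of
  \<open>q ^ j\<close>, of which \<open>m\<close> are taken away, produces the split \<open>m * n = m * q ^ j + b\<close> with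
  exactly one carry, so \<open>q\<^sup>2\<close> does not divide the gcd. If the digit sum of \<open>m * n\<close> is larger than
  \<open>m\<close>, lowering the digits to a total of \<open>m\<close> leaves a smaller positive multiple of \<open>m\<close>, which
  adds up to \<open>m * n\<close> with its complement without carry, so \<open>q\<close> does not divide the gcd. Hence
  the exponent of \<open>q\<close> in \<open>binom_gcd m n\<close> is 1 or 0 according to whether the digit sum of \<open>m * n\<close> is \<open>m\<close>
  (\<open>multiplicity_binom_gcd\<close>).

  For the prime \<open>p\<close> with \<open>m = p ^ t\<close>, multiplication by \<open>m\<close> only appends zeros in base \<open>p\<close>, so
  the exponent of \<open>p\<close> is the same as for \<open>m = 1\<close>, where the previous paragraph applies; and a
  number with digit sum 1 is a power of \<open>p\<close>. A prime dividing the gcd divides its member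
  \<open>(m * n) choose m\<close>, so by hypothesis these two cases cover all prime divisors.
\<close>

section \<open>Digit sums\<close>

lemma digit_sum_0 [simp]:
  assumes "q > 0"
  shows "digit_sum q 0 = 0"
  using assms by (simp add: digit_sum_def)

lemma digit_sum_rec:
  assumes "q \<ge> 2"
  shows "digit_sum q a = a mod q + digit_sum q (a div q)"
proof (cases "a = 0")
  case True
  with assms show ?thesis by simp
next
  case False
  have fin: "finite {i. q ^ i \<le> b}" for b
  proof (rule finite_subset)
    show "{i. q ^ i \<le> b} \<subseteq> {..b}"
      using power_gt_expt[of q] assms by (fastforce intro: less_imp_le elim: order_less_le_trans)
  qed simp
  have Suc_iff: "q ^ Suc i \<le> a \<longleftrightarrow> q ^ i \<le> a div q" for i
    using assms by (simp add: less_eq_div_iff_mult_less_eq mult.commute)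
  have "i \<in> {i. q ^ i \<le> a} \<longleftrightarrow> i \<in> insert 0 (Suc ` {i. q ^ i \<le> a div q})" for i
    using False by (cases i) (auto simp: Suc_iff simp del: power_Suc)
  then have "{i. q ^ i \<le> a} = insert 0 (Suc ` {i. q ^ i \<le> a div q})"
    by blast
  then show ?thesis
    using fin[of "a div q"] unfolding digit_sum_def
    by (simp add: sum.reindex div_mult2_eq)
qed

lemma digit_sum_mult_add:
  assumes "q \<ge> 2" and "b < q"
  shows "digit_sum q (q * a + b) = digit_sum q a + b"
  using digit_sum_rec[OF assms(1), of "q * a + b"] assms by simp

lemma digit_sum_less:
  assumes "q \<ge> 2" and "a < q"
  shows "digit_sum q a = a"
  using digit_sum_mult_add[of q a 0] assms by simp

lemma digit_sum_mult_power:
  assumes "q \<ge> 2"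
  shows "digit_sum q (q ^ j * a) = digit_sum q a"
proof (induction j)
  case (Suc j)
  then show ?case
    using digit_sum_mult_add[of q 0 "q ^ j * a"] assms by (simp add: mult.assoc)
qed simp

lemma digit_sum_pos:
  assumes "q \<ge> 2" and "a > 0"
  shows "digit_sum q a > 0"
  using assms(2)
proof (induction a rule: less_induct)
  case (less a)
  show ?case
  proof (cases "a < q")
    case True
    with less assms show ?thesis by (simp add: digit_sum_less)
  next
    case False
    then have "0 < a div q" "a div q < a"
      using assms less by (auto simp: div_greater_zero_iff)
    with less.IH show ?thesis by (simp add: digit_sum_rec[OF assms(1), of a])
  qed
qed

lemma digit_sum_eq_1_iff:
  assumes "q \<ge> 2"
  shows "digit_sum q a = 1 \<longleftrightarrow> (\<exists>i. a = q ^ i)"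
proof
  show "\<exists>i. a = q ^ i" if "digit_sum q a = 1"
    using that
  proof (induction a rule: less_induct)
    case (less a)
    show ?case
    proof (cases "a < q")
      case True
      with less.prems assms have "a = q ^ 0" by (simp add: digit_sum_less)
      then show ?thesis ..
    next
      case False
      then have div: "0 < a div q" "a div q < a"
        using assms by (auto simp: div_greater_zero_iff)
      have "a mod q = 0" "digit_sum q (a div q) = 1"
        using less.prems digit_sum_rec[OF assms, of a] digit_sum_pos[OF assms div(1)] by auto
      with less.IH[OF div(2)] obtain i where "a div q = q ^ i" by blast
      with \<open>a mod q = 0\<close> have "a = q ^ Suc i"
        using div_mult_mod_eq[of a q] by (simp add: mult.commute)
      then show ?thesis ..
    qed
  qed
  show "digit_sum q a = 1" if "\<exists>i. a = q ^ i"
    using that digit_sum_mult_power[OF assms, of _ 1] digit_sum_less[OF assms, of 1] assms by auto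
qed

section \<open>Splitting a number with few carries\<close>

text \<open>Taking units greedily from the lowest digits upwards gives a summand with any digit sum up to
  that of the whole, and the complementary digits are left over.\<close>

lemma carry_free_split:
  assumes "q \<ge> 2" and "s \<le> digit_sum q N"
  obtains a b where "N = a + b" and "digit_sum q a = s" and "digit_sum q b = digit_sum q N - s"
proof -
  have "\<exists>a b. N = a + b \<and> digit_sum q a = s \<and> digit_sum q b = digit_sum q N - s"
    using assms(2)
  proof (induction N arbitrary: s rule: less_induct)
    case (less N)
    define d r where "d = N div q" and "r = N mod q"
    have N: "N = q * d + r" and r: "r < q"
      using assms by (simp_all add: d_def r_def)
    have sN: "digit_sum q N = digit_sum q d + r"
      unfolding N by (rule digit_sum_mult_add[OF assms(1) r])
    show ?case
    proof (cases "s \<le> r")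
      case True
      have "N = s + (q * d + (r - s))" using N True by simp
      moreover have "digit_sum q s = s" using True r assms by (simp add: digit_sum_less)
      moreover have "digit_sum q (q * d + (r - s)) = digit_sum q N - s"
        using sN True r assms by (subst digit_sum_mult_add) auto
      ultimately show ?thesis by blast
    next
      case False
      have "d > 0" using less.prems False sN assms by (cases "d = 0") auto
      then have "d < N" using assms by (simp add: N trans_less_add1)
      moreover have "s - r \<le> digit_sum q d" using less.prems sN by simp
      ultimately obtain a b where ab: "d = a + b" "digit_sum q a = s - r"
        "digit_sum q b = digit_sum q d - (s - r)"
        using less.IH by blast
      have "N = (q * a + r) + q * b" using N ab(1) by (simp add: algebra_simps)
      moreover have "digit_sum q (q * a + r) = s"
        using digit_sum_mult_add[OF assms(1) r] ab(2) False by simp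
      moreover have "digit_sum q (q * b) = digit_sum q N - s"
        using digit_sum_mult_add[of q 0 b] assms ab(3) sN False by simp
      ultimately show ?thesis by blast
    qed
  qed
  with that show ?thesis by blast
qed

text \<open>Here one of the \<open>s\<close> or fewer units of \<open>N\<close>, in the leading digit, is replaced by \<open>q\<close> units in
  the digit below, and \<open>s\<close> of these are removed. The removal borrows only once: as the leading
  digit is not zero, the digit below has fewer than \<open>s\<close> units of its own.\<close>

lemma one_carry_split:
  assumes "q \<ge> 2" and "s < q" and "q \<le> N" and "digit_sum q N \<le> s"
  obtains j b where "N = q ^ j * s + b" and "b > 0" and "digit_sum q b + s = digit_sum q N + (q - 1)"
proof -
  have "\<exists>j b. N = q ^ j * s + b \<and> b > 0 \<and> digit_sum q b + s = digit_sum q N + (q - 1)"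
    using assms(3,4)
  proof (induction N rule: less_induct)
    case (less N)
    define d r where "d = N div q" and "r = N mod q"
    have N: "N = q * d + r" and r: "r < q"
      using assms by (simp_all add: d_def r_def)
    have d: "d > 0" using less.prems assms by (simp add: d_def div_greater_zero_iff)
    have sN: "digit_sum q N = digit_sum q d + r"
      unfolding N by (rule digit_sum_mult_add[OF assms(1) r])
    show ?case
    proof (cases "d < q")
      case True
      then have sd: "digit_sum q d = d" using assms by (simp add: digit_sum_less)
      obtain c where c: "d = Suc c" using d by (cases d) auto
      define b where "b = q * c + (q + r - s)"
      have "r < s" using sN sd d less.prems by simp
      then have "N = q ^ 0 * s + b" and "b > 0"
        using N c assms by (auto simp: b_def)
      moreover have "digit_sum q b = c + (q + r - s)"
        unfolding b_def using True c \<open>r < s\<close> assms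
        by (subst digit_sum_mult_add) (auto simp: digit_sum_less)
      then have "digit_sum q b + s = digit_sum q N + (q - 1)"
        using sN sd c assms by simp
      ultimately show ?thesis by blast
    next
      case False
      moreover have "d < N" using d assms by (simp add: N trans_less_add1)
      ultimately obtain j b where jb: "d = q ^ j * s + b" "b > 0"
        "digit_sum q b + s = digit_sum q d + (q - 1)"
        using less.IH[of d] less.prems sN by auto
      have "N = q ^ Suc j * s + (q * b + r)" using N jb(1) by (simp add: algebra_simps)
      moreover have "digit_sum q (q * b + r) + s = digit_sum q N + (q - 1)"
        using digit_sum_mult_add[OF assms(1) r] jb(3) sN by simp
      moreover have "q * b + r > 0" using jb(2) assms by simp
      ultimately show ?thesis by blast
    qed
  qed
  with that show ?thesis by blast
qed

section \<open>Theorems of Legendre and Kummer\<close>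

text \<open>Passing from \<open>a\<close> to \<open>Suc a\<close> turns each trailing digit \<open>q - 1\<close> of \<open>a\<close> into a trailing zero of
  \<open>Suc a\<close> and raises the next digit by 1; the number of these zeros is the multiplicity of \<open>q\<close>.\<close>

lemma digit_sum_Suc:
  assumes "prime q"
  shows "digit_sum q (Suc a) + (q - 1) * multiplicity q (Suc a) = digit_sum q a + 1"
proof (induction a rule: less_induct)
  case (less a)
  have q: "q \<ge> 2" using assms by (rule prime_ge_2_nat)
  define d r where "d = a div q" and "r = a mod q"
  have a: "a = q * d + r" and r: "r < q"
    using q by (simp_all add: d_def r_def)
  have sa: "digit_sum q a = digit_sum q d + r"
    unfolding a by (rule digit_sum_mult_add[OF q r])
  show ?case
  proof (cases "Suc r < q")
    case True
    have Suc_a: "Suc a = q * d + Suc r" by (simp add: a)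
    have "\<not> q dvd Suc a"
      unfolding Suc_a using True dvd_imp_le[of q "Suc r"]
      by (auto simp: dvd_add_right_iff simp del: add_Suc_right)
    moreover have "digit_sum q (Suc a) = digit_sum q d + Suc r"
      unfolding Suc_a by (rule digit_sum_mult_add[OF q True])
    ultimately show ?thesis by (simp add: sa not_dvd_imp_multiplicity_0)
  next
    case False
    with r have r': "r = q - 1" by simp
    have Suc_a: "Suc a = q * Suc d" using q by (simp add: a r')
    have "d < a" using q trans_less_add1[of d "q * d" r] by (cases "d = 0") (auto simp: a r')
    then have IH: "digit_sum q (Suc d) + (q - 1) * multiplicity q (Suc d) = digit_sum q d + 1"
      by (rule less.IH)
    have "digit_sum q (Suc a) = digit_sum q (Suc d)"
      unfolding Suc_a using digit_sum_mult_add[of q 0 "Suc d"] q by simp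
    moreover have "multiplicity q (Suc a) = Suc (multiplicity q (Suc d))"
      unfolding Suc_a using q by (intro multiplicity_times_same) auto
    ultimately show ?thesis using IH by (simp add: sa r')
  qed
qed

lemma legendre_digit_sum:
  assumes "prime q"
  shows "digit_sum q a + (q - 1) * multiplicity q (fact a :: nat) = a"
proof (induction a)
  case 0
  with assms show ?case by (simp add: prime_gt_0_nat)
next
  case (Suc a)
  have "multiplicity q (fact (Suc a) :: nat) = multiplicity q (Suc a) + multiplicity q (fact a :: nat)"
    unfolding fact_Suc of_nat_id using assms
    by (intro prime_elem_multiplicity_mult_distrib) auto
  with Suc digit_sum_Suc[OF assms, of a] show ?case by (simp add: algebra_simps)
qed

lemma kummer_digit_sum:
  assumes "prime q"
  shows "digit_sum q (a + b) + (q - 1) * multiplicity q ((a + b) choose a) =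
    digit_sum q a + digit_sum q b"
proof -
  have "(fact (a + b) :: nat) = fact a * fact b * ((a + b) choose a)"
    using binomial_fact_lemma[of a "a + b"] by simp
  then have "multiplicity q (fact (a + b) :: nat) = multiplicity q (fact a :: nat) +
      multiplicity q (fact b :: nat) + multiplicity q ((a + b) choose a)"
    using assms by (simp add: prime_elem_multiplicity_mult_distrib)
  then have "(q - 1) * multiplicity q (fact (a + b) :: nat) =
      (q - 1) * multiplicity q (fact a :: nat) + (q - 1) * multiplicity q (fact b :: nat) +
      (q - 1) * multiplicity q ((a + b) choose a)"
    by (simp add: algebra_simps)
  with legendre_digit_sum[OF assms, of a] legendre_digit_sum[OF assms, of b]
    legendre_digit_sum[OF assms, of "a + b"]
  show ?thesis by linarith
qed

lemma cong_digit_sum: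
  assumes "prime q" and "[q = 1] (mod m)"
  shows "[digit_sum q a = a] (mod m)"
proof -
  have "m dvd q - 1"
    using assms prime_ge_1_nat[of q] by (simp add: cong_altdef_nat)
  then have "[digit_sum q a + 0 = digit_sum q a + (q - 1) * multiplicity q (fact a :: nat)] (mod m)"
    by (intro cong_add cong_refl) (simp add: cong_0_iff cong_sym_eq[of 0])
  then show ?thesis by (simp only: legendre_digit_sum[OF assms(1)] add_0_right)
qed

section \<open>The exponent of a prime in the gcd\<close>

lemma dvd_binom_gcd_iff:
  "d dvd binom_gcd m n \<longleftrightarrow> (\<forall>k. 1 \<le> k \<and> k < n \<longrightarrow> d dvd ((m * n) choose (m * k)))"
  by (auto simp: binom_gcd_def dvd_Gcd_iff)

lemma binom_gcd_nonzero:
  assumes "n > 1"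
  shows "binom_gcd m n \<noteq> 0"
proof
  assume "binom_gcd m n = 0"
  then have "0 dvd ((m * n) choose (m * 1))"
    using assms dvd_binom_gcd_iff[of 0 m n] by simp
  with assms show False by simp
qed

text \<open>Since \<open>q \<equiv> 1\<close>, the multiples of \<open>m\<close> are the numbers with digit sum divisible by \<open>m\<close>.
  This turns the divisibility of all the binomial coefficients by \<open>q\<close> into the question whether
  the digit sum of \<open>m * n\<close> has room for two positive multiples of \<open>m\<close>.\<close>

lemma multiplicity_binom_gcd:
  assumes "prime q" and "m > 0" and "n > 1" and cong: "[q = 1] (mod m)"
  shows "multiplicity q (binom_gcd m n) = (if digit_sum q (m * n) = m then 1 else 0)"
proof -
  have q: "q \<ge> 2" using assms(1) by (rule prime_ge_2_nat)
  have "m dvd q - 1" using cong q by (simp add: cong_altdef_nat)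
  then have "m < q" using q by (auto dest!: dvd_imp_le)
  have dvd_iff: "m dvd digit_sum q a \<longleftrightarrow> m dvd a" for a
    using cong_digit_sum[OF assms(1) cong] by (rule cong_dvd_iff)
  have digit_sum_ge: "m \<le> digit_sum q (m * k)" if "k > 0" for k
    using that dvd_iff[of "m * k"] digit_sum_pos[OF q, of "m * k"] assms(2) by (auto intro: dvd_imp_le)
  show ?thesis
  proof (cases "digit_sum q (m * n) = m")
    case True
    have "q dvd binom_gcd m n"
      unfolding dvd_binom_gcd_iff
    proof safe
      fix k assume k: "1 \<le> k" "k < n"
      have "m * n = m * k + m * (n - k)" using k by (simp flip: add_mult_distrib2)
      with kummer_digit_sum[OF assms(1), of "m * k" "m * (n - k)"] True
      have "m + (q - 1) * multiplicity q ((m * n) choose (m * k)) =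
          digit_sum q (m * k) + digit_sum q (m * (n - k))" by simp
      moreover have "m \<le> digit_sum q (m * k)" "m \<le> digit_sum q (m * (n - k))"
        using k by (auto intro: digit_sum_ge)
      ultimately have "multiplicity q ((m * n) choose (m * k)) \<noteq> 0"
        using assms(2) by (intro notI) simp
      then show "q dvd ((m * n) choose (m * k))"
        by (metis not_dvd_imp_multiplicity_0)
    qed
    moreover have "\<not> q ^ 2 dvd binom_gcd m n"
    proof
      assume sq: "q ^ 2 dvd binom_gcd m n"
      \<comment> \<open>Below \<open>q\<close>, the number \<open>m * n\<close> would be its own digit sum, which is \<open>m\<close>, against \<open>n > 1\<close>.\<close>
      have "q \<le> m * n"
        using True digit_sum_less[OF q, of "m * n"] assms by (cases "m * n < q") auto
      then obtain j b where jb: "m * n = q ^ j * m + b" "b > 0"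
        "digit_sum q b + m = m + (q - 1)"
        using one_carry_split[OF q \<open>m < q\<close> _ eq_refl[OF True], unfolded True] by blast
      have "m * q ^ j < m * n" using jb by (simp add: mult.commute)
      then have "1 \<le> q ^ j" "q ^ j < n" using q by auto
      with sq have dvd: "q ^ 2 dvd ((m * n) choose (m * q ^ j))"
        unfolding dvd_binom_gcd_iff by blast
      have "digit_sum q (q ^ j * m) = m"
        using digit_sum_mult_power[OF q] digit_sum_less[OF q \<open>m < q\<close>] by simp
      then have "m + (q - 1) * multiplicity q ((m * n) choose (m * q ^ j)) = m + digit_sum q b"
        using kummer_digit_sum[OF assms(1), of "q ^ j * m" b]
        by (simp only: True mult.commute[of m "q ^ j"] flip: jb(1))
      with jb(3) have "(q - 1) * multiplicity q ((m * n) choose (m * q ^ j)) = q - 1"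
        by linarith
      then have "multiplicity q ((m * n) choose (m * q ^ j)) = 1" using q by simp
      moreover have "(m * n) choose (m * q ^ j) \<noteq> 0"
        using \<open>m * q ^ j < m * n\<close> by simp
      ultimately show False
        using dvd power_dvd_iff_le_multiplicity[of "(m * n) choose (m * q ^ j)" q 2] q by simp
    qed
    ultimately show ?thesis
      using True by (simp add: multiplicity_eqI numeral_2_eq_2)
  next
    case False
    have "m dvd digit_sum q (m * n)" and ge: "m \<le> digit_sum q (m * n)"
      using dvd_iff digit_sum_ge assms by auto
    from carry_free_split[OF q ge] obtain a b where ab: "m * n = a + b" "digit_sum q a = m"
      "digit_sum q b = digit_sum q (m * n) - m" by blast
    have "m dvd a" using dvd_iff[of a] ab(2) by simp
    then obtain k where k: "a = m * k" by blast
    have "b \<noteq> 0" using ab(3) False ge q by (intro notI) simp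
    then have "k < n"
      using ab(1) k by (metis less_add_same_cancel1 mult_less_cancel1 neq0_conv)
    moreover have "k \<noteq> 0" using ab(2) k assms(2) q by (intro notI) simp
    moreover have "(q - 1) * multiplicity q ((m * n) choose (m * k)) = 0"
      using kummer_digit_sum[OF assms(1), of a b] ab(2,3) ge by (simp flip: ab(1) k)
    then have "multiplicity q ((m * n) choose (m * k)) = 0" using q by simp
    then have "\<not> q dvd ((m * n) choose (m * k))"
      using \<open>k < n\<close> q by (subst (asm) multiplicity_eq_zero_iff) auto
    ultimately have "\<not> q dvd binom_gcd m n"
      unfolding dvd_binom_gcd_iff by (auto simp: Suc_le_eq)
    then show ?thesis using False by (simp add: not_dvd_imp_multiplicity_0)
  qed
qed

text \<open>In base \<open>p\<close> multiplication by \<open>p ^ t\<close> preserves digit sums, hence by Kummer's theorem the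
  exponents of \<open>p\<close> in the binomial coefficients.\<close>

lemma multiplicity_binom_gcd_power:
  assumes "prime p"
  shows "multiplicity p (binom_gcd (p ^ t) n) = multiplicity p (binom_gcd 1 n)"
proof -
  have p: "p \<ge> 2" using assms by (rule prime_ge_2_nat)
  have "p ^ i dvd ((p ^ t * n) choose (p ^ t * k)) \<longleftrightarrow> p ^ i dvd (n choose k)" if "k < n" for i k
  proof -
    have n: "n = k + (n - k)" using that by simp
    have "p ^ t * n = p ^ t * k + p ^ t * (n - k)" using n by (metis add_mult_distrib2)
    then have "digit_sum p n + (p - 1) * multiplicity p ((p ^ t * n) choose (p ^ t * k)) =
        digit_sum p k + digit_sum p (n - k)"
      using kummer_digit_sum[OF assms, of "p ^ t * k" "p ^ t * (n - k)"]
      by (simp only: digit_sum_mult_power[OF p] flip: \<open>p ^ t * n = _\<close>)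
    moreover have "digit_sum p n + (p - 1) * multiplicity p (n choose k) =
        digit_sum p k + digit_sum p (n - k)"
      using kummer_digit_sum[OF assms, of k "n - k"] that by simp
    ultimately have "(p - 1) * multiplicity p ((p ^ t * n) choose (p ^ t * k)) =
        (p - 1) * multiplicity p (n choose k)"
      by linarith
    then have "multiplicity p ((p ^ t * n) choose (p ^ t * k)) = multiplicity p (n choose k)"
      using p by simp
    moreover have "(p ^ t * n) choose (p ^ t * k) \<noteq> 0" "n choose k \<noteq> 0"
      using that by auto
    ultimately show ?thesis
      using p by (simp add: power_dvd_iff_le_multiplicity)
  qed
  then have "p ^ i dvd binom_gcd (p ^ t) n \<longleftrightarrow> p ^ i dvd binom_gcd 1 n" for i
    by (auto simp: dvd_binom_gcd_iff)
  then show ?thesis by (simp add: multiplicity_def)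
qed

section \<open>The gcd as a product of primes\<close>

theorem theorem2:
  fixes m n p t :: nat and T :: "nat set"
  assumes "n > 1" and "prime p" and "m = p ^ t"
    and "\<And>q. prime q \<Longrightarrow> q dvd ((m * n) choose m) \<Longrightarrow> q = p \<or> [q = 1] (mod m)"
    and "T = {q. prime q \<and> q \<noteq> p \<and> q dvd ((m * n) choose m) \<and> digit_sum q (m * n) = m}"
  shows "binom_gcd m n = (if \<exists>i. n = p ^ i then p * (\<Prod>q\<in>T. q) else (\<Prod>q\<in>T. q))"
proof -
  have p: "p \<ge> 2" using assms(2) by (rule prime_ge_2_nat)
  have m: "m > 0" using p assms(3) by simp
  have binom: "(m * n) choose m \<noteq> 0" using assms(1) by simp
  have "T \<subseteq> {d. d dvd ((m * n) choose m)}" by (auto simp: assms(5))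
  moreover have "finite {d. d dvd ((m * n) choose m)}"
    using binom by (intro finite_divisors_nat) (rule neq0_conv[THEN iffD1])
  ultimately have "finite T" by (rule finite_subset)
  have T: "p \<notin> T" "\<And>q. q \<in> T \<Longrightarrow> prime q" by (simp_all add: assms(5))
  define S where "S = (if \<exists>i. n = p ^ i then insert p T else T)"
  have S: "finite S" "\<And>q. q \<in> S \<Longrightarrow> prime q"
    using \<open>finite T\<close> T(2) assms(2) by (auto simp: S_def split: if_splits)
  have mult: "multiplicity q (binom_gcd m n) = (if q \<in> S then 1 else 0)" if "prime q" for q
  proof -
    consider "q = p" | "q \<noteq> p" "q dvd ((m * n) choose m)" | "q \<noteq> p" "\<not> q dvd ((m * n) choose m)"
      by blast
    then show ?thesis
    proof cases
      case 1
      have "multiplicity p (binom_gcd m n) = (if digit_sum p n = 1 then 1 else 0)"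
        using multiplicity_binom_gcd[of p 1 n] multiplicity_binom_gcd_power[of p t n] assms by simp
      then show ?thesis
        using 1 T(1) digit_sum_eq_1_iff[OF p, of n] by (auto simp: S_def)
    next
      case 2
      then show ?thesis
        using multiplicity_binom_gcd[OF that m assms(1)] assms(4)[OF that] that
        by (auto simp: S_def assms(5))
    next
      case 3
      then have "\<not> q dvd binom_gcd m n"
        using assms(1) dvd_binom_gcd_iff[of q m n] by (metis le_refl mult.right_neutral)
      then show ?thesis
        using 3 by (auto simp: S_def assms(5) not_dvd_imp_multiplicity_0)
    qed
  qed
  have "binom_gcd m n = \<Prod>S"
  proof (rule multiplicity_eq_nat)
    show "multiplicity q (binom_gcd m n) = multiplicity q (\<Prod>S)" if "prime q" for q
      using multiplicity_prod_prime_powers[OF S that, of "\<lambda>_. 1"] mult[OF that] by simp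
    show "0 < binom_gcd m n" using binom_gcd_nonzero[OF assms(1)] by simp
    show "0 < \<Prod>S" using S by (auto intro: prod_pos prime_gt_0_nat)
  qed
  then show ?thesis using \<open>finite T\<close> T(1) by (simp add: S_def)
qed

end
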